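(* Let $A$ be a commutative unital $\mathbb{R}$-algebra, let $\tau$ be a locally multiplicatively convex topology on $A$, let $d\ge1$ be an integer, and let $S$ be any $\sum A^{2d}$-module of $A$. Then the $\tau$-closure $\overline{S}^{\tau}$ of $S$ satisfies $$\overline{S}^{\tau}=\mathrm{Pos}(\mathcal{K}_S\cap\mathfrak{sp}(\tau)).$$ In particular, $\overline{\sum A^{2d}}^{\tau}=\mathrm{Pos}(\mathfrak{sp}(\tau))$.
   Context: A subset $U\subseteq A$ is an m-set if $U\cdot U\subseteq U$. A locally convex vector space topology on $A$ (not assumed Hausdorff) is locally multiplicatively convex (lmc) if there is a base of neighbourhoods of $0$ consisting of m-sets; equivalently, it is generated by a family of submultiplicative seminorms on $A$ (maps $\rho:A\to[0,\infty)$ with $\rho(rx)=|r|\rho(x)$, $\rho(x+y)\le\rho(x)+\rho(y)$, $\rho(xy)\le\rho(x)\rho(y)$ for $r\in\mathbb{R}$, $x,y\in A$). $\mathcal{X}(A)$ denotes the set of all unital $\mathbb{R}$-algebra homomorphisms $A\to\mathbb{R}$, and for $a\in A$, $\hat a(\alpha)=\alpha(a)$ for $\alpha\in\mathcal{X}(A)$. $\mathfrak{sp}(\tau)$ denotes the set of all $\tau$-continuous $\alpha\in\mathcal{X}(A)$. $\sum A^{2d}$ is the set of all finite sums of $2d$-th powers of elements of $A$. A $\sum A^{2d}$-module of $A$ is a subset $S\subseteq A$ with $1\in S$, $S+S\subseteq S$ and $a^{2d}\cdot S\subseteq S$ for every $a\in A$. $\mathcal{K}_S:=\{\alpha\in\mathcal{X}(A):\hat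 a(\alpha)\ge0\text{ for all }a\in S\}$; for $K\subseteq\mathcal{X}(A)$, $\mathrm{Pos}(K):=\{a\in A:\hat a(\alpha)\ge0\text{ for all }\alpha\in K\}$. *)

theory Defs
  imports "HOL-Analysis.Analysis"
begin

text \<open>
  Commutative unital real algebras are the types of sort
  \<open>{real_algebra, comm_ring, comm_monoid_mult}\<close>. Unlike
  \<open>{real_algebra_1, comm_ring_1}\<close>, this sort does not impose \<open>0 \<noteq> 1\<close>, so the
  zero algebra is included. Topologies are explicit values of type \<open>'a topology\<close>,
  since they are arbitrary and need not be Hausdorff.
\<close>

definition m_set :: "'a::times set \<Rightarrow> bool" where
  "m_set U \<longleftrightarrow> (\<forall>x\<in>U. \<forall>y\<in>U. x * y \<in> U)"

definition vector_topology :: "'a::real_vector topology \<Rightarrow> bool" where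
  "vector_topology \<tau> \<longleftrightarrow>
     topspace \<tau> = UNIV \<and>
     continuous_map (prod_topology \<tau> \<tau>) \<tau> (\<lambda>(x, y). x + y) \<and>
     continuous_map (prod_topology euclideanreal \<tau>) \<tau> (\<lambda>(r, x). r *\<^sub>R x)"

definition locally_convex_topology :: "'a::real_vector topology \<Rightarrow> bool" where
  "locally_convex_topology \<tau> \<longleftrightarrow> vector_topology \<tau> \<and> neighbourhood_base_at 0 convex \<tau>"

definition lmc_topology :: "'a::{real_algebra, comm_ring, comm_monoid_mult} topology \<Rightarrow> bool" where
  "lmc_topology \<tau> \<longleftrightarrow> locally_convex_topology \<tau> \<and> neighbourhood_base_at 0 m_set \<tau>"

definition characters :: "('a::{real_algebra, comm_ring, comm_monoid_mult} \<Rightarrow> real) set" where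
  "characters = {\<alpha>. linear \<alpha> \<and> (\<forall>x y. \<alpha> (x * y) = \<alpha> x * \<alpha> y) \<and> \<alpha> 1 = 1}"

definition hat :: "'a \<Rightarrow> ('a \<Rightarrow> real) \<Rightarrow> real" where
  "hat a \<alpha> = \<alpha> a"

definition spectrum ::
  "'a::{real_algebra, comm_ring, comm_monoid_mult} topology \<Rightarrow> ('a \<Rightarrow> real) set" where
  "spectrum \<tau> = {\<alpha> \<in> characters. continuous_map \<tau> euclideanreal \<alpha>}"

definition sums_of_powers :: "nat \<Rightarrow> 'a::{real_algebra, comm_ring, comm_monoid_mult} set" where
  "sums_of_powers k = {s. \<exists>(n::nat) f. s = (\<Sum>i<n. f i ^ k)}"

definition power_module ::
  "nat \<Rightarrow> 'a::{real_algebra, comm_ring, comm_monoid_mult} set \<Rightarrow> bool" where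
  "power_module k S \<longleftrightarrow>
     1 \<in> S \<and> (\<forall>x\<in>S. \<forall>y\<in>S. x + y \<in> S) \<and> (\<forall>a. \<forall>x\<in>S. a ^ k * x \<in> S)"

definition nonneg_chars ::
  "'a::{real_algebra, comm_ring, comm_monoid_mult} set \<Rightarrow> ('a \<Rightarrow> real) set" where
  "nonneg_chars S = {\<alpha> \<in> characters. \<forall>a\<in>S. hat a \<alpha> \<ge> 0}"

definition Pos :: "('a \<Rightarrow> real) set \<Rightarrow> 'a set" where
  "Pos K = {a. \<forall>\<alpha>\<in>K. hat a \<alpha> \<ge> 0}"

end

theory Submission
  imports Defs
begin

text \<open>
  Continuous characters that are nonnegative on a power module \<open>S\<close> are nonnegative on its closure,
  because preimages of closed half-lines are closed. The content is the converse: an element \<open>b\<close>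
  on which all continuous characters in \<open>nonneg_chars S\<close> are nonnegative is a limit of elements
  of \<open>S\<close>.

  Every neighbourhood of \<open>b\<close> contains the open unit ball around \<open>b\<close> of a continuous submultiplicative
  seminorm \<open>\<rho>\<close> (\<open>lmc_seminorm\<close>), so it suffices to approximate \<open>b\<close> with respect to one such \<open>\<rho>\<close>. Let
  \<open>M\<close> be the \<open>\<rho>\<close>-closure of \<open>S\<close> and let \<open>T\<close> be the semiring of all \<open>t\<close> with \<open>t M \<subseteq> M\<close>. Passing from \<open>S\<close> to
  \<open>M\<close> is what makes \<open>T\<close> large: whenever \<open>\<rho> a\<close> is small, Newton's iteration shows that \<open>1 + a\<close> is a
  \<open>\<rho>\<close>-limit of \<open>k\<close>-th powers (\<open>approximate_root\<close>), so \<open>1 + a\<close> lies in \<open>T\<close>. Rescaling, \<open>n + a \<in> T\<close> as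
  soon as the real number \<open>n\<close> exceeds a fixed multiple of \<open>\<rho> a\<close>. This has two consequences.

  First, \<open>T\<close> is archimedean, and for modules over an archimedean semiring the Kadison--Dubois
  theorem holds (\<open>positive_mem_module\<close>): an element on which all characters nonnegative on \<open>M\<close>
  are strictly positive belongs to \<open>M\<close>. Second, a character that is nonnegative on \<open>M\<close> is bounded by
  a multiple of \<open>\<rho>\<close>, hence continuous. For \<open>\<epsilon> > 0\<close> such a character is therefore strictly
  positive at \<open>b + \<epsilon>\<close>, so that \<open>b + \<epsilon> \<in> M\<close>; since \<open>M\<close> is \<open>\<rho>\<close>-closed, also \<open>b \<in> M\<close>
  (\<open>nonneg_mem_closure\<close>).
\<close>

section \<open>Submultiplicative seminorms and approximate roots\<close>

locale submult_seminorm =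
  fixes \<rho> :: "'a::{real_algebra, comm_ring, comm_monoid_mult} \<Rightarrow> real"
  assumes nonneg: "0 \<le> \<rho> x"
    and scale: "\<rho> (r *\<^sub>R x) = \<bar>r\<bar> * \<rho> x"
    and triangle: "\<rho> (x + y) \<le> \<rho> x + \<rho> y"
    and submult: "\<rho> (x * y) \<le> \<rho> x * \<rho> y"
begin

lemma zero: "\<rho> 0 = 0"
  using scale[of 0 0] by simp

lemma minus: "\<rho> (- x) = \<rho> x"
  using scale[of "- 1" x] by simp

lemma diff_le: "\<rho> (x - z) \<le> \<rho> (x - y) + \<rho> (y - z)"
  using triangle[of "x - y" "y - z"] by simp

lemma mult_near_one_le:
  assumes "\<rho> (y - 1) \<le> \<delta>"
  shows "\<rho> (x * y) \<le> (1 + \<delta>) * \<rho> x"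
proof -
  have "\<rho> (x * y) = \<rho> (x + x * (y - 1))"
    by (simp add: algebra_simps)
  also have "\<dots> \<le> \<rho> x + \<rho> x * \<rho> (y - 1)"
    using triangle[of x "x * (y - 1)"] submult[of x "y - 1"] by linarith
  also have "\<dots> \<le> \<rho> x + \<rho> x * \<delta>"
    using assms nonneg[of x] by (simp add: mult_left_mono)
  finally show ?thesis by (simp add: algebra_simps)
qed

lemma power_near_one_le:
  assumes "\<rho> (y - 1) \<le> \<delta>"
  shows "\<rho> (y ^ j - 1) \<le> (1 + \<delta>) ^ j - 1"
proof (induction j)
  case 0
  then show ?case by (simp add: zero)
next
  case (Suc j)
  have \<delta>: "0 \<le> \<delta>" using nonneg[of "y - 1"] assms by linarith
  have "\<rho> (y ^ Suc j - 1) = \<rho> ((y ^ j - 1) * y + (y - 1))"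
    by (simp add: algebra_simps)
  also have "\<dots> \<le> (1 + \<delta>) * \<rho> (y ^ j - 1) + \<delta>"
    using triangle mult_near_one_le[OF assms] assms by (smt (verit))
  also have "\<dots> \<le> (1 + \<delta>) * ((1 + \<delta>) ^ j - 1) + \<delta>"
    using Suc \<delta> by (simp add: mult_left_mono)
  finally show ?case by (simp add: algebra_simps)
qed

text \<open>
  Near \<open>1\<close> the derivative of the \<open>j\<close>-th power is close to \<open>j\<close>; this is the corresponding mean value
  estimate, and it is what makes Newton's iteration for \<open>k\<close>-th roots contract. Only quantities of the
  form \<open>\<rho> (y - 1)\<close> enter, since \<open>\<rho> 1\<close> may differ from \<open>1\<close>.
\<close>

lemma power_diff_near_one_le:
  assumes y: "\<rho> (y - 1) \<le> \<delta>" and z: "\<rho> (z - 1) \<le> \<delta>"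
  shows "\<rho> (z ^ j - y ^ j - real j *\<^sub>R (z - y)) \<le> real j * ((1 + \<delta>) ^ j - 1) * \<rho> (z - y)"
proof (induction j)
  case 0
  then show ?case by (simp add: zero)
next
  case (Suc j)
  define h where "h = z - y"
  define e where "e = z ^ j - y ^ j - real j *\<^sub>R h"
  have \<delta>: "0 \<le> \<delta>" using nonneg[of "y - 1"] y by linarith
  have "z ^ Suc j - y ^ Suc j - real (Suc j) *\<^sub>R h
      = e * z + (real j *\<^sub>R (h * (z - 1)) + h * (y ^ j - 1))"
    by (simp add: e_def h_def algebra_simps)
  then have "\<rho> (z ^ Suc j - y ^ Suc j - real (Suc j) *\<^sub>R h)
      \<le> \<rho> (e * z) + (real j * \<rho> (h * (z - 1)) + \<rho> (h * (y ^ j - 1)))"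
    using triangle[of "e * z" "real j *\<^sub>R (h * (z - 1)) + h * (y ^ j - 1)"]
      triangle[of "real j *\<^sub>R (h * (z - 1))" "h * (y ^ j - 1)"]
    by (simp add: scale)
  moreover have "\<rho> (e * z) \<le> (1 + \<delta>) * (real j * ((1 + \<delta>) ^ j - 1) * \<rho> h)"
    using Suc \<delta> by (intro order_trans[OF mult_near_one_le[OF z]] mult_left_mono) (simp_all add: e_def h_def)
  moreover have "real j * \<rho> (h * (z - 1)) \<le> real j * (\<rho> h * \<delta>)"
    using z nonneg by (intro mult_left_mono order_trans[OF submult]) auto
  moreover have "\<rho> (h * (y ^ j - 1)) \<le> \<rho> h * ((1 + \<delta>) ^ Suc j - 1)"
  proof -
    have "(1 + \<delta>) ^ j \<le> (1 + \<delta>) ^ Suc j" using \<delta> by (intro power_increasing) auto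
    then have "\<rho> (y ^ j - 1) \<le> (1 + \<delta>) ^ Suc j - 1" using power_near_one_le[OF y, of j] by linarith
    then show ?thesis using nonneg by (intro order_trans[OF submult] mult_left_mono)
  qed
  ultimately have "\<rho> (z ^ Suc j - y ^ Suc j - real (Suc j) *\<^sub>R h)
      \<le> (1 + \<delta>) * (real j * ((1 + \<delta>) ^ j - 1) * \<rho> h)
        + (real j * (\<rho> h * \<delta>) + \<rho> h * ((1 + \<delta>) ^ Suc j - 1))"
    by linarith
  also have "\<dots> = real (Suc j) * ((1 + \<delta>) ^ Suc j - 1) * \<rho> h"
    by (simp add: algebra_simps)
  finally show ?case unfolding h_def .
qed

text \<open>
  Newton's iteration with the derivative frozen at its value \<open>k\<close> in \<open>1\<close>, that is
  \<open>y \<mapsto> y + (1 + a - y ^ k) / k\<close>, started at \<open>1\<close>, halves the residual \<open>1 + a - y ^ k\<close> in each step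
  as long as \<open>y\<close> stays near \<open>1\<close>. The corrections are then dominated by a geometric series, which
  keeps \<open>y\<close> within \<open>2 * \<rho> a\<close> of \<open>1\<close>.
\<close>

lemma approximate_root:
  assumes k: "0 < k"
  obtains \<delta> where "0 < \<delta>"
    "\<And>a \<epsilon>. \<rho> a \<le> \<delta> \<Longrightarrow> 0 < \<epsilon> \<Longrightarrow> \<exists>y. \<rho> (1 + a - y ^ k) < \<epsilon>"
proof
  (* The relative error of the derivative k within distance \<delta> of 1 is at most
     (1 + \<delta>) ^ k - 1; this choice makes it 1/2, so each step halves the residual. *)
  define \<delta> where "\<delta> = root k (3/2) - 1"
  have \<delta>: "0 < \<delta>" using k by (simp add: \<delta>_def)
  have \<delta>k: "(1 + \<delta>) ^ k = 3/2" using k by (simp add: \<delta>_def)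
  show "0 < \<delta> / 2" using \<delta> by simp
  fix a \<epsilon> assume a: "\<rho> a \<le> \<delta> / 2" and \<epsilon>: "0 < (\<epsilon>::real)"
  have newton: "\<exists>y. \<rho> (1 + a - y ^ k) \<le> \<rho> a / 2 ^ n \<and> \<rho> (y - 1) \<le> 2 * \<rho> a * (1 - 1 / 2 ^ n)" for n
  proof (induction n)
    case 0
    show ?case by (rule exI[of _ 1]) (simp add: zero)
  next
    case (Suc n)
    then obtain y where y: "\<rho> (1 + a - y ^ k) \<le> \<rho> a / 2 ^ n"
      and y1: "\<rho> (y - 1) \<le> 2 * \<rho> a * (1 - 1 / 2 ^ n)" by blast
    define e where "e = 1 + a - y ^ k"
    define z where "z = y + (1 / real k) *\<^sub>R e"
    have \<rho>zy: "\<rho> (z - y) = \<rho> e / real k" by (simp add: z_def scale)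
    have "\<rho> e / real k \<le> \<rho> e"
      using k nonneg[of e] by (simp add: divide_le_eq mult_le_cancel_left1)
    then have "\<rho> (z - 1) \<le> \<rho> a / 2 ^ n + 2 * \<rho> a * (1 - 1 / 2 ^ n)"
      using diff_le[of z 1 y] \<rho>zy y y1 by (simp add: e_def)
    then have z1: "\<rho> (z - 1) \<le> 2 * \<rho> a * (1 - 1 / 2 ^ Suc n)"
      by (simp add: field_simps)
    have small: "2 * \<rho> a * (1 - 1 / 2 ^ m) \<le> \<delta>" for m
    proof -
      have "2 * \<rho> a * (1 - 1 / 2 ^ m) \<le> 2 * \<rho> a * 1"
        using nonneg[of a] by (intro mult_left_mono) auto
      then show ?thesis using a by linarith
    qed
    have "\<rho> (1 + a - z ^ k) = \<rho> (- (z ^ k - y ^ k - real k *\<^sub>R (z - y)))"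
      using k by (simp add: z_def e_def algebra_simps)
    also have "\<dots> \<le> real k * (1/2) * (\<rho> e / real k)"
      using power_diff_near_one_le[of y \<delta> z k] y1 z1 small[of n] small[of "Suc n"]
      unfolding minus \<delta>k \<rho>zy by simp
    also have "\<dots> \<le> \<rho> a / 2 ^ Suc n"
      using y k by (simp add: e_def)
    finally show ?case using z1 by blast
  qed
  obtain n where "\<rho> a / \<epsilon> < 2 ^ n" using real_arch_pow[of 2 "\<rho> a / \<epsilon>"] by auto
  then have "\<rho> a / 2 ^ n < \<epsilon>" using \<epsilon> by (simp add: field_simps)
  then show "\<exists>y. \<rho> (1 + a - y ^ k) < \<epsilon>" using newton[of n] by (meson le_less_trans)
qed

end

section \<open>Positivity for modules over an archimedean semiring\<close>

locale archimedean_semiring =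
  fixes T :: "'a::{real_algebra, comm_ring, comm_monoid_mult} set"
  assumes add_closed: "s \<in> T \<Longrightarrow> t \<in> T \<Longrightarrow> s + t \<in> T"
    and mult_closed: "s \<in> T \<Longrightarrow> t \<in> T \<Longrightarrow> s * t \<in> T"
    and scalars: "0 \<le> r \<Longrightarrow> r *\<^sub>R 1 \<in> T"
    and archimedean: "\<exists>n>0. n *\<^sub>R 1 + a \<in> T"
begin

definition is_module :: "'a set \<Rightarrow> bool" where
  "is_module M \<longleftrightarrow> 1 \<in> M \<and> (\<forall>x\<in>M. \<forall>y\<in>M. x + y \<in> M) \<and> (\<forall>t\<in>T. \<forall>x\<in>M. t * x \<in> M)"

lemma module_add: "is_module M \<Longrightarrow> x \<in> M \<Longrightarrow> y \<in> M \<Longrightarrow> x + y \<in> M"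
  by (simp add: is_module_def)

lemma module_mult: "is_module M \<Longrightarrow> t \<in> T \<Longrightarrow> x \<in> M \<Longrightarrow> t * x \<in> M"
  by (simp add: is_module_def)

lemma semiring_subset_module: "is_module M \<Longrightarrow> t \<in> T \<Longrightarrow> t \<in> M"
  using module_mult[of M t 1] by (simp add: is_module_def)

lemma module_scale: "is_module M \<Longrightarrow> 0 \<le> r \<Longrightarrow> x \<in> M \<Longrightarrow> r *\<^sub>R x \<in> M"
  using module_mult[OF _ scalars, of M r x] by simp

lemma zero_mem: "0 \<in> T"
  using scalars[of 0] by simp

lemma one_mem: "1 \<in> T"
  using scalars[of 1] by simp

lemma module_extend:
  fixes x :: 'a
  assumes M: "is_module M"
  defines "N \<equiv> {m + x * t | m t. m \<in> M \<and> t \<in> T}"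
  shows "is_module N" and "M \<subseteq> N" and "x \<in> N"
proof -
  show "M \<subseteq> N"
  proof
    fix m assume "m \<in> M"
    then have "m = m + x * 0 \<and> m \<in> M \<and> 0 \<in> T" by (simp add: zero_mem)
    then show "m \<in> N" unfolding N_def by blast
  qed
  then have one: "1 \<in> N" using M by (auto simp: is_module_def)
  have "x = 0 + x * 1 \<and> 0 \<in> M \<and> 1 \<in> T"
    using semiring_subset_module[OF M zero_mem] by (simp add: one_mem)
  then show "x \<in> N" unfolding N_def by blast
  have "u + v \<in> N" if "u \<in> N" "v \<in> N" for u v
  proof -
    from that obtain m t m' t' where "u = m + x * t" "v = m' + x * t'"
      and mem: "m \<in> M" "t \<in> T" "m' \<in> M" "t' \<in> T" unfolding N_def by blast
    then have "u + v = (m + m') + x * (t + t')" by (simp add: algebra_simps)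
    then show ?thesis unfolding N_def using mem module_add[OF M] add_closed by blast
  qed
  moreover have "s * u \<in> N" if "s \<in> T" "u \<in> N" for s u
  proof -
    from that obtain m t where "u = m + x * t"
      and mem: "m \<in> M" "t \<in> T" unfolding N_def by blast
    then have "s * u = s * m + x * (s * t)" by (simp add: algebra_simps)
    then show ?thesis unfolding N_def using mem that(1) module_mult[OF M] mult_closed by blast
  qed
  ultimately show "is_module N" using one by (simp add: is_module_def)
qed

text \<open>
  If neither \<open>x\<close> nor \<open>- x\<close> were in \<open>Q\<close>, adjoining either would produce \<open>- 1\<close>:
  \<open>- 1 = q1 + x * t1\<close> and \<open>- 1 = q2 - x * t2\<close>. Eliminating \<open>x\<close> between these equations gives
  \<open>- t1 \<in> Q\<close>, so \<open>t1\<close> and \<open>- t1\<close> both lie in \<open>Q\<close>. As \<open>x\<close> is bounded by a real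
  number, \<open>x * t1\<close> then lies in \<open>Q\<close> too, and so does \<open>- 1\<close>.
\<close>

lemma maximal_proper_module_total:
  assumes Q: "is_module Q" "- 1 \<notin> Q"
    and max: "\<And>N. is_module N \<Longrightarrow> Q \<subseteq> N \<Longrightarrow> - 1 \<notin> N \<Longrightarrow> N = Q"
  shows "x \<in> Q \<or> - x \<in> Q"
proof (rule ccontr)
  assume neither: "\<not> ?thesis"
  have ext: "\<exists>q t. q \<in> Q \<and> t \<in> T \<and> - 1 = q + y * t" if "y \<notin> Q" for y
    using max[OF module_extend(1,2)[OF Q(1), of y]] module_extend(3)[OF Q(1), of y] that by blast
  obtain q1 t1 where 1: "q1 \<in> Q" "t1 \<in> T" "- 1 = q1 + x * t1" using ext[of x] neither by blast
  obtain q2 t2 where 2: "q2 \<in> Q" "t2 \<in> T" "- 1 = q2 + - x * t2" using ext[of "- x"] neither by blast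
  have q1: "q1 = - 1 - x * t1" and q2: "q2 = - 1 + x * t2"
    using 1(3) 2(3) by (simp_all add: algebra_simps)
  have "t2 * q1 + t1 * q2 + t2 \<in> Q"
    using 1 2 Q module_add module_mult semiring_subset_module by simp
  also have "t2 * q1 + t1 * q2 + t2 = - t1"
    by (simp add: q1 q2 algebra_simps)
  finally have neg_t1: "- t1 \<in> Q" .
  obtain n where n: "0 < n" "n *\<^sub>R 1 + - x \<in> T" using archimedean by blast
  have "(n *\<^sub>R 1 + - x) * - t1 + n *\<^sub>R t1 + q1 \<in> Q"
    using n neg_t1 1 Q semiring_subset_module
    by (intro module_add[OF Q(1)] module_mult[OF Q(1)] module_scale[OF Q(1)]) auto
  also have "(n *\<^sub>R 1 + - x) * - t1 + n *\<^sub>R t1 + q1 = - 1"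
    by (simp add: q1 algebra_simps)
  finally show False using Q by simp
qed

text \<open>
  In the total preorder with nonnegative cone \<open>Q\<close>, every element \<open>a\<close> defines a Dedekind cut in the
  reals, and the character sends \<open>a\<close> to it. Multiplicativity comes from the module structure:
  multiplying \<open>a - r \<in> Q\<close> by \<open>t \<in> T\<close> gives \<open>\<alpha> (a * t) \<ge> r * \<alpha> t\<close>, the same for \<open>- a\<close> gives equality,
  and every element becomes a member of \<open>T\<close> after adding a constant.
\<close>

lemma total_module_character:
  assumes Q: "is_module Q" "- 1 \<notin> Q" and total: "\<And>x. x \<in> Q \<or> - x \<in> Q"
  shows "\<exists>\<alpha>\<in>characters. \<forall>x\<in>Q. 0 \<le> \<alpha> x"
proof -
  define \<alpha> where "\<alpha> a = Sup {r. a - r *\<^sub>R 1 \<in> Q}" for a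
  have neg: "0 \<le> r" if "r *\<^sub>R 1 \<in> Q" for r
  proof (rule ccontr)
    assume "\<not> 0 \<le> r"
    then show False using module_scale[OF Q(1) _ that, of "1 / - r"] Q(2) by simp
  qed
  have cut: "r \<le> s" if "a - r *\<^sub>R 1 \<in> Q" "s *\<^sub>R 1 - a \<in> Q" for a r s
    using neg[of "s - r"] module_add[OF Q(1) that] by (simp add: algebra_simps)
  have lower: "\<exists>r. a - r *\<^sub>R 1 \<in> Q" for a
  proof -
    obtain n where "n *\<^sub>R 1 + a \<in> T" using archimedean by blast
    then have "a - (- n) *\<^sub>R 1 \<in> Q" using semiring_subset_module[OF Q(1)] by (simp add: algebra_simps)
    then show ?thesis by blast
  qed
  have upper: "\<exists>s. s *\<^sub>R 1 - a \<in> Q" for a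
    using lower[of "- a"] by (metis diff_minus_eq_add minus_diff_commute scaleR_minus_left
        diff_conv_add_uminus add.commute)
  have bdd: "bdd_above {r. a - r *\<^sub>R 1 \<in> Q}" for a
    using upper[of a] cut unfolding bdd_above_def by blast
  have le_\<alpha>: "r \<le> \<alpha> a" if "a - r *\<^sub>R 1 \<in> Q" for r a
    unfolding \<alpha>_def using that bdd by (intro cSup_upper) auto
  have \<alpha>_le: "\<alpha> a \<le> s" if "s *\<^sub>R 1 - a \<in> Q" for s a
    unfolding \<alpha>_def using that lower cut by (intro cSup_least) auto
  have below: "a - r *\<^sub>R 1 \<in> Q" if "r < \<alpha> a" for a r
    using total[of "a - r *\<^sub>R 1"] \<alpha>_le[of r a] that by auto
  have above: "s *\<^sub>R 1 - a \<in> Q" if "\<alpha> a < s" for a s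
    using total[of "s *\<^sub>R 1 - a"] le_\<alpha>[of a s] that by auto
  have pos: "0 \<le> \<alpha> x" if "x \<in> Q" for x
    using le_\<alpha>[of x 0] that by simp
  have \<alpha>_unique: "\<alpha> a = c" if "\<And>r. r < c \<Longrightarrow> r \<le> \<alpha> a" "\<And>r. c < r \<Longrightarrow> \<alpha> a \<le> r" for a c
    using that by (meson dense_ge dense_le order_antisym)
  have \<alpha>_add: "\<alpha> (a + b) = \<alpha> a + \<alpha> b" for a b
  proof (rule \<alpha>_unique)
    fix r assume r: "r < \<alpha> a + \<alpha> b"
    define \<epsilon> where "\<epsilon> = (\<alpha> a + \<alpha> b - r) / 2"
    have "(a - (\<alpha> a - \<epsilon>) *\<^sub>R 1) + (b - (\<alpha> b - \<epsilon>) *\<^sub>R 1) \<in> Q"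
      using r by (intro module_add[OF Q(1)] below) (auto simp: \<epsilon>_def)
    also have "(a - (\<alpha> a - \<epsilon>) *\<^sub>R 1) + (b - (\<alpha> b - \<epsilon>) *\<^sub>R 1) = a + b - (\<alpha> a + \<alpha> b - 2 * \<epsilon>) *\<^sub>R 1"
      by (simp add: algebra_simps flip: scaleR_2)
    also have "\<alpha> a + \<alpha> b - 2 * \<epsilon> = r" by (simp add: \<epsilon>_def field_simps)
    finally show "r \<le> \<alpha> (a + b)" by (rule le_\<alpha>)
  next
    fix r assume r: "\<alpha> a + \<alpha> b < r"
    define \<epsilon> where "\<epsilon> = (r - \<alpha> a - \<alpha> b) / 2"
    have "((\<alpha> a + \<epsilon>) *\<^sub>R 1 - a) + ((\<alpha> b + \<epsilon>) *\<^sub>R 1 - b) \<in> Q"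
      using r by (intro module_add[OF Q(1)] above) (auto simp: \<epsilon>_def)
    also have "((\<alpha> a + \<epsilon>) *\<^sub>R 1 - a) + ((\<alpha> b + \<epsilon>) *\<^sub>R 1 - b) = (\<alpha> a + \<alpha> b + 2 * \<epsilon>) *\<^sub>R 1 - (a + b)"
      by (simp add: algebra_simps flip: scaleR_2)
    also have "\<alpha> a + \<alpha> b + 2 * \<epsilon> = r" by (simp add: \<epsilon>_def field_simps)
    finally show "\<alpha> (a + b) \<le> r" by (rule \<alpha>_le)
  qed
  have \<alpha>_const: "\<alpha> (c *\<^sub>R 1) = c" for c
    using le_\<alpha>[of "c *\<^sub>R 1" c] \<alpha>_le[of c "c *\<^sub>R 1"] semiring_subset_module[OF Q(1) zero_mem]
    by simp
  have \<alpha>_minus: "\<alpha> (- a) = - \<alpha> a" for a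
    using \<alpha>_add[of a "- a"] \<alpha>_const[of 0] by simp
  have \<alpha>_scale_pos: "\<alpha> (c *\<^sub>R a) = c * \<alpha> a" if c: "0 < c" for c a
  proof (rule \<alpha>_unique)
    fix r assume "r < c * \<alpha> a"
    then have "r / c < \<alpha> a" using c by (simp add: field_simps)
    from module_scale[OF Q(1) _ below[OF this], of c]
    show "r \<le> \<alpha> (c *\<^sub>R a)" using c by (intro le_\<alpha>) (simp add: algebra_simps)
  next
    fix r assume "c * \<alpha> a < r"
    then have "\<alpha> a < r / c" using c by (simp add: field_simps)
    from module_scale[OF Q(1) _ above[OF this], of c]
    show "\<alpha> (c *\<^sub>R a) \<le> r" using c by (intro \<alpha>_le) (simp add: algebra_simps)
  qed
  have \<alpha>_scale: "\<alpha> (c *\<^sub>R a) = c * \<alpha> a" for c a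
  proof (cases c "0::real" rule: linorder_cases)
    case less
    then show ?thesis using \<alpha>_scale_pos[of "- c" a] \<alpha>_minus[of "c *\<^sub>R a"] by simp
  qed (use \<alpha>_scale_pos \<alpha>_const[of 0] in auto)
  have lin: "linear \<alpha>" by (rule linearI) (simp_all add: \<alpha>_add \<alpha>_scale)
  have le_mult: "\<alpha> a * \<alpha> t \<le> \<alpha> (a * t)" if t: "t \<in> T" for a t
  proof -
    have \<alpha>t: "0 \<le> \<alpha> t" using pos semiring_subset_module[OF Q(1) t] .
    have *: "r * \<alpha> t \<le> \<alpha> (a * t)" if "r < \<alpha> a" for r
    proof -
      have "0 \<le> \<alpha> (t * (a - r *\<^sub>R 1))" by (intro pos module_mult[OF Q(1) t] below that)
      also have "t * (a - r *\<^sub>R 1) = a * t - r *\<^sub>R t" by (simp add: algebra_simps)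
      finally show ?thesis by (simp add: linear_diff[OF lin] \<alpha>_scale)
    qed
    show ?thesis
    proof (cases "\<alpha> t = 0")
      case True
      then show ?thesis using *[of "\<alpha> a - 1"] by simp
    next
      case False
      then have p: "0 < \<alpha> t" using \<alpha>t by simp
      have "\<alpha> a \<le> \<alpha> (a * t) / \<alpha> t"
      proof (rule dense_le)
        fix r assume "r < \<alpha> a"
        then show "r \<le> \<alpha> (a * t) / \<alpha> t" using * p by (simp add: pos_le_divide_eq)
      qed
      then show ?thesis using p by (simp add: pos_le_divide_eq)
    qed
  qed
  have mult_T: "\<alpha> (a * t) = \<alpha> a * \<alpha> t" if "t \<in> T" for a t
    using le_mult[OF that, of a] le_mult[OF that, of "- a"] by (simp add: \<alpha>_minus)
  have "\<alpha> (a * x) = \<alpha> a * \<alpha> x" for a x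
  proof -
    obtain n where "n *\<^sub>R 1 + x \<in> T" using archimedean by blast
    from mult_T[OF this, of a] show ?thesis
      by (simp add: distrib_left \<alpha>_add \<alpha>_scale \<alpha>_const)
        (use \<alpha>_const[of 1] in \<open>simp add: algebra_simps\<close>)
  qed
  then have "\<alpha> \<in> characters"
    using lin \<alpha>_const[of 1] by (simp add: characters_def)
  then show ?thesis using pos by blast
qed

lemma proper_module_character:
  assumes M: "is_module M" "- 1 \<notin> M"
  shows "\<exists>\<alpha>\<in>characters. \<forall>x\<in>M. 0 \<le> \<alpha> x"
proof -
  define P where "P = {N. is_module N \<and> M \<subseteq> N \<and> - 1 \<notin> N}"
  have "\<exists>Q\<in>P. \<forall>N\<in>P. Q \<subseteq> N \<longrightarrow> N = Q"
  proof (rule subset_Zorn_nonempty)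
    show "P \<noteq> {}" using M by (auto simp: P_def)
  next
    fix C assume C: "C \<noteq> {}" "subset.chain P C"
    then have mods: "\<And>N. N \<in> C \<Longrightarrow> is_module N \<and> M \<subseteq> N \<and> - 1 \<notin> N"
      and chain: "\<And>N N'. N \<in> C \<Longrightarrow> N' \<in> C \<Longrightarrow> N \<subseteq> N' \<or> N' \<subseteq> N"
      by (auto simp: subset_chain_def P_def)
    have "is_module (\<Union> C)"
      unfolding is_module_def
    proof (intro conjI ballI)
      show "1 \<in> \<Union> C" using C(1) mods by (auto simp: is_module_def)
      fix x y assume "x \<in> \<Union> C" "y \<in> \<Union> C"
      then obtain N where "N \<in> C" "x \<in> N" "y \<in> N" using chain by blast
      then show "x + y \<in> \<Union> C" using mods module_add by blast
    next
      fix t x assume "t \<in> T" "x \<in> \<Union> C"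
      then show "t * x \<in> \<Union> C" using mods module_mult by blast
    qed
    then show "\<Union> C \<in> P" using mods C(1) unfolding P_def by blast
  qed
  then obtain Q where Q: "Q \<in> P" and max: "\<And>N. N \<in> P \<Longrightarrow> Q \<subseteq> N \<Longrightarrow> N = Q" by blast
  have mem: "is_module Q" "M \<subseteq> Q" "- 1 \<notin> Q" using Q by (auto simp: P_def)
  have "x \<in> Q \<or> - x \<in> Q" for x
    by (rule maximal_proper_module_total[OF mem(1,3)]) (use max mem in \<open>auto simp: P_def\<close>)
  from total_module_character[OF mem(1,3) this] show ?thesis using mem(2) by blast
qed

text \<open>
  The Kadison--Dubois theorem for modules. By positivity no character is nonnegative on the module
  \<open>M - b * T\<close>, so that this module contains \<open>- 1\<close>, which means \<open>b * t = 1 + m\<close> with \<open>t \<in> T\<close>,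
  \<open>m \<in> M\<close>. If \<open>n - t \<in> T\<close> and \<open>b + r \<in> M\<close> for some \<open>r \<ge> 0\<close>, then multiplying \<open>b + r\<close> by \<open>n - t\<close> and adding
  \<open>m + r * t\<close> cancels the terms containing \<open>t\<close> and leaves \<open>n * (b + r) - 1 \<in> M\<close>. Thus \<open>r\<close> can be lowered
  by \<open>1 / n\<close> until it is not positive any more.
\<close>

theorem positive_mem_module:
  assumes M: "is_module M" and pos: "\<And>\<alpha>. \<alpha> \<in> nonneg_chars M \<Longrightarrow> 0 < \<alpha> b"
  shows "b \<in> M"
proof -
  define N where "N = {m + - b * t | m t. m \<in> M \<and> t \<in> T}"
  note N = module_extend[OF M, of "- b", folded N_def]
  have "- 1 \<in> N"
  proof (rule ccontr)
    assume "- 1 \<notin> N"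
    from proper_module_character[OF N(1) this] obtain \<alpha>
      where \<alpha>: "\<alpha> \<in> characters" "\<forall>x\<in>N. 0 \<le> \<alpha> x" by blast
    then have "\<alpha> \<in> nonneg_chars M" using N(2) by (auto simp: nonneg_chars_def hat_def)
    moreover have "0 \<le> \<alpha> (- b)" using \<alpha>(2) N(3) by blast
    moreover have "linear \<alpha>" using \<alpha>(1) by (simp add: characters_def)
    ultimately show False using pos[of \<alpha>] linear_neg[of \<alpha> b] by simp
  qed
  then obtain m t where m: "m \<in> M" and t: "t \<in> T" and eq: "- 1 = m + - b * t"
    unfolding N_def by blast
  have bt: "m = b * t - 1" using eq by (simp add: algebra_simps)
  obtain n where n: "0 < n" "n *\<^sub>R 1 + - t \<in> T" using archimedean by blast
  have step: "b + (r - 1 / n) *\<^sub>R 1 \<in> M" if "b + r *\<^sub>R 1 \<in> M" "0 \<le> r" for r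
  proof -
    have "(n *\<^sub>R 1 + - t) * (b + r *\<^sub>R 1) + m + r *\<^sub>R t \<in> M"
      using that n t m M module_add module_mult module_scale semiring_subset_module by simp
    also have "(n *\<^sub>R 1 + - t) * (b + r *\<^sub>R 1) + m + r *\<^sub>R t = n *\<^sub>R b + (n * r) *\<^sub>R 1 - 1"
      by (simp add: bt algebra_simps)
    finally have "(1 / n) *\<^sub>R (n *\<^sub>R b + (n * r) *\<^sub>R 1 - 1) \<in> M"
      using n by (intro module_scale[OF M]) auto
    then show ?thesis using n by (simp add: algebra_simps)
  qed
  have raise: "b + s *\<^sub>R 1 \<in> M" if "b + r *\<^sub>R 1 \<in> M" "r \<le> s" for r s
    using module_add[OF M that(1) semiring_subset_module[OF M scalars[of "s - r"]]] that(2)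
    by (simp add: algebra_simps)
  obtain c where c: "0 < c" "c *\<^sub>R 1 + b \<in> T" using archimedean by blast
  have descend: "b + max 0 (c - real j / n) *\<^sub>R 1 \<in> M" for j
  proof (induction j)
    case 0
    then show ?case using c semiring_subset_module[OF M] by (simp add: add.commute)
  next
    case (Suc j)
    have "real (Suc j) / n = real j / n + 1 / n" "0 < 1 / n" using n by (simp_all add: add_divide_distrib)
    then have "max 0 (c - real j / n) - 1 / n \<le> max 0 (c - real (Suc j) / n)"
      by linarith
    with raise[OF step[OF Suc]] show ?case by simp
  qed
  obtain j where "c * n < real j" using reals_Archimedean2 by blast
  then have "max 0 (c - real j / n) = 0" using n by (simp add: field_simps)
  then show "b \<in> M" using descend[of j] by simp
qed

end

section \<open>Seminorm closures of power modules\<close>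

lemma scaled_one_power:
  "(r *\<^sub>R (1::'a::{real_algebra, comm_ring, comm_monoid_mult})) ^ k = r ^ k *\<^sub>R 1"
  by (induction k) auto

context submult_seminorm
begin

definition seminorm_closure :: "'a set \<Rightarrow> 'a set" where
  "seminorm_closure S = {x. \<forall>\<epsilon>>0. \<exists>s\<in>S. \<rho> (x - s) < \<epsilon>}"

lemma closureD: "x \<in> seminorm_closure S \<Longrightarrow> 0 < \<epsilon> \<Longrightarrow> \<exists>s\<in>S. \<rho> (x - s) < \<epsilon>"
  by (simp add: seminorm_closure_def)

lemma closure_subset: "S \<subseteq> seminorm_closure S"
proof
  fix x assume "x \<in> S"
  moreover have "\<rho> (x - x) = 0" by (simp add: zero)
  ultimately show "x \<in> seminorm_closure S" unfolding seminorm_closure_def by force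
qed

lemma closure_closed:
  assumes "\<And>\<epsilon>. 0 < \<epsilon> \<Longrightarrow> \<exists>y\<in>seminorm_closure S. \<rho> (x - y) < \<epsilon>"
  shows "x \<in> seminorm_closure S"
  unfolding seminorm_closure_def
proof safe
  fix \<epsilon> :: real assume "0 < \<epsilon>"
  then obtain y where y: "y \<in> seminorm_closure S" "\<rho> (x - y) < \<epsilon> / 2" using assms[of "\<epsilon> / 2"] by auto
  moreover obtain s where "s \<in> S" "\<rho> (y - s) < \<epsilon> / 2"
    using closureD[OF y(1), of "\<epsilon> / 2"] \<open>0 < \<epsilon>\<close> by auto
  ultimately show "\<exists>s\<in>S. \<rho> (x - s) < \<epsilon>" using diff_le[of x s y] by (intro bexI[of _ s]) auto
qed

lemma mult_small:
  assumes "0 < \<epsilon>"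
  obtains \<eta> where "0 < \<eta>" "\<And>y. \<rho> y < \<eta> \<Longrightarrow> \<rho> (x * y) < \<epsilon>"
proof
  have p: "0 < \<rho> x + 1" using nonneg[of x] by linarith
  then show "0 < \<epsilon> / (\<rho> x + 1)" using assms by simp
  fix y assume "\<rho> y < \<epsilon> / (\<rho> x + 1)"
  then have "\<rho> y * (\<rho> x + 1) < \<epsilon>" using p by (simp add: field_simps)
  moreover have "\<rho> x * \<rho> y \<le> \<rho> y * (\<rho> x + 1)" using nonneg[of y] by (simp add: algebra_simps)
  ultimately show "\<rho> (x * y) < \<epsilon>" using submult[of x y] by linarith
qed

lemma closure_mult_mem:
  assumes "\<And>s. s \<in> S \<Longrightarrow> c * s \<in> S" and x: "x \<in> seminorm_closure S"
  shows "c * x \<in> seminorm_closure S"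
  unfolding seminorm_closure_def
proof safe
  fix \<epsilon> :: real assume "0 < \<epsilon>"
  then obtain \<eta> where "0 < \<eta>" "\<And>y. \<rho> y < \<eta> \<Longrightarrow> \<rho> (c * y) < \<epsilon>" using mult_small by blast
  then obtain s where "s \<in> S" "\<rho> (c * (x - s)) < \<epsilon>" using closureD[OF x] by blast
  then show "\<exists>s\<in>S. \<rho> (c * x - s) < \<epsilon>" using assms(1) by (auto simp: right_diff_distrib)
qed

lemma closure_add_mem:
  assumes "\<And>s t. s \<in> S \<Longrightarrow> t \<in> S \<Longrightarrow> s + t \<in> S" and x: "x \<in> seminorm_closure S" and y: "y \<in> seminorm_closure S"
  shows "x + y \<in> seminorm_closure S"
  unfolding seminorm_closure_def
proof safe
  fix \<epsilon> :: real assume "0 < \<epsilon>"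
  then obtain s t where st: "s \<in> S" "\<rho> (x - s) < \<epsilon> / 2" "t \<in> S" "\<rho> (y - t) < \<epsilon> / 2"
    using closureD[OF x, of "\<epsilon> / 2"] closureD[OF y, of "\<epsilon> / 2"] by auto
  have "\<rho> (x + y - (s + t)) < \<epsilon>"
    using triangle[of "x - s" "y - t"] st by (simp add: algebra_simps)
  then show "\<exists>u\<in>S. \<rho> (x + y - u) < \<epsilon>" using assms(1) st by blast
qed

text \<open>
  Multiplication by a \<open>k\<close>-th power preserves the closure of \<open>S\<close>, hence so does multiplication by any
  seminorm limit of \<open>k\<close>-th powers.
\<close>

lemma near_one_mult_closure:
  assumes k: "0 < k" and S: "power_module k S"
  obtains \<delta> where "0 < \<delta>"
    "\<And>a x. \<rho> a \<le> \<delta> \<Longrightarrow> x \<in> seminorm_closure S \<Longrightarrow> (1 + a) * x \<in> seminorm_closure S"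
proof -
  obtain \<delta> where \<delta>: "0 < \<delta>"
    and root: "\<And>a \<epsilon>. \<rho> a \<le> \<delta> \<Longrightarrow> 0 < \<epsilon> \<Longrightarrow> \<exists>y. \<rho> (1 + a - y ^ k) < \<epsilon>"
    using approximate_root[OF k] by blast
  have "(1 + a) * x \<in> seminorm_closure S" if a: "\<rho> a \<le> \<delta>" and x: "x \<in> seminorm_closure S" for a x
  proof (rule closure_closed)
    fix \<epsilon> :: real assume "0 < \<epsilon>"
    then obtain \<eta> where "0 < \<eta>" "\<And>y. \<rho> y < \<eta> \<Longrightarrow> \<rho> (x * y) < \<epsilon>" using mult_small by blast
    then obtain y where "\<rho> (x * (1 + a - y ^ k)) < \<epsilon>" using root[OF a] by blast
    then have "\<rho> ((1 + a) * x - y ^ k * x) < \<epsilon>" by (simp add: algebra_simps)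
    moreover have "y ^ k * x \<in> seminorm_closure S"
      using S x by (intro closure_mult_mem) (auto simp: power_module_def)
    ultimately show "\<exists>z\<in>seminorm_closure S. \<rho> ((1 + a) * x - z) < \<epsilon>" by blast
  qed
  then show ?thesis using that \<delta> by blast
qed

text \<open>
  The multipliers of the closure form an archimedean semiring which contains \<open>n + a\<close> whenever
  \<open>\<rho> a \<le> n * \<delta>\<close>. This inclusion also bounds every character that is nonnegative on the closure by
  \<open>\<rho> / \<delta>\<close>, so the hypothesis on \<open>b\<close> applies to all characters that occur in
  \<open>positive_mem_module\<close>. Strict positivity is reached by a small positive shift of \<open>b\<close>.
\<close>

theorem nonneg_mem_closure:
  assumes k: "0 < k" and S: "power_module k S"
    and b: "\<And>\<alpha> C. \<alpha> \<in> nonneg_chars S \<Longrightarrow> (\<And>x. \<bar>\<alpha> x\<bar> \<le> C * \<rho> x) \<Longrightarrow> 0 \<le> \<alpha> b"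
  shows "b \<in> seminorm_closure S"
proof -
  obtain \<delta> where \<delta>: "0 < \<delta>"
    and near: "\<And>a x. \<rho> a \<le> \<delta> \<Longrightarrow> x \<in> seminorm_closure S \<Longrightarrow> (1 + a) * x \<in> seminorm_closure S"
    using near_one_mult_closure[OF k S] by blast
  define T where "T = {t. \<forall>x\<in>seminorm_closure S. t * x \<in> seminorm_closure S}"
  have add: "x + y \<in> seminorm_closure S" if "x \<in> seminorm_closure S" "y \<in> seminorm_closure S" for x y
    using S that by (intro closure_add_mem) (auto simp: power_module_def)
  have nonneg_scalar: "r *\<^sub>R 1 \<in> T" if "0 \<le> r" for r
  proof -
    have "(root k r *\<^sub>R 1) ^ k * x \<in> seminorm_closure S" if "x \<in> seminorm_closure S" for x
      using S that by (intro closure_mult_mem) (auto simp: power_module_def)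
    then show ?thesis using that k by (simp add: T_def scaled_one_power)
  qed
  have near_T: "n *\<^sub>R 1 + a \<in> T" if n: "0 < n" "\<rho> a \<le> n * \<delta>" for n a
  proof -
    have "\<rho> ((1 / n) *\<^sub>R a) \<le> \<delta>" using n by (simp add: scale field_simps)
    then have "1 + (1 / n) *\<^sub>R a \<in> T" using near by (simp add: T_def)
    moreover have "n *\<^sub>R 1 \<in> T" using nonneg_scalar n by simp
    ultimately have "(n *\<^sub>R 1) * (1 + (1 / n) *\<^sub>R a) \<in> T" by (simp add: T_def mult.assoc del: mult_scaleR_left)
    then show ?thesis using n by (simp add: algebra_simps)
  qed
  interpret archimedean_semiring T
  proof
    show "\<exists>n>0. n *\<^sub>R 1 + a \<in> T" for a
    proof (intro exI conjI)
      show p: "0 < \<rho> a / \<delta> + 1" using nonneg[of a] \<delta> by (simp add: add_nonneg_pos)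
      show "(\<rho> a / \<delta> + 1) *\<^sub>R 1 + a \<in> T"
        by (rule near_T[OF p]) (use \<delta> in \<open>simp add: field_simps\<close>)
    qed
  qed (use nonneg_scalar add in \<open>auto simp: T_def distrib_right mult.assoc\<close>)
  have M: "is_module (seminorm_closure S)"
    unfolding is_module_def using S closure_subset add by (auto simp: power_module_def T_def)
  have bounded: "\<bar>\<alpha> x\<bar> \<le> (1 / \<delta>) * \<rho> x" if \<alpha>: "\<alpha> \<in> nonneg_chars (seminorm_closure S)" for \<alpha> x
  proof -
    have lin: "linear \<alpha>" and one: "\<alpha> 1 = 1" and pos: "\<And>x. x \<in> seminorm_closure S \<Longrightarrow> 0 \<le> \<alpha> x"
      using \<alpha> by (auto simp: nonneg_chars_def characters_def hat_def)
    have *: "- \<alpha> y \<le> \<rho> y / \<delta>" for y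
    proof (rule dense_ge)
      fix n assume n: "\<rho> y / \<delta> < n"
      then have "0 < n" using nonneg[of y] \<delta> by (meson divide_nonneg_pos le_less_trans)
      moreover have "\<rho> y \<le> n * \<delta>" using n \<delta> by (simp add: field_simps)
      ultimately have "n *\<^sub>R 1 + y \<in> seminorm_closure S" using near_T semiring_subset_module[OF M] by blast
      then show "- \<alpha> y \<le> n"
        using pos[of "n *\<^sub>R 1 + y"] by (simp add: linear_add[OF lin] linear_scale[OF lin] one)
    qed
    show ?thesis using *[of x] *[of "- x"] by (simp add: linear_neg[OF lin] minus)
  qed
  show ?thesis
  proof (rule closure_closed)
    fix \<epsilon> :: real assume \<epsilon>: "0 < \<epsilon>"
    (* The shift by r has seminorm r * \<rho> 1 < \<epsilon>; adding 1 in the denominator covers \<rho> 1 = 0. *)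
    define r where "r = \<epsilon> / (\<rho> 1 + 1)"
    have p: "0 < \<rho> 1 + 1" using nonneg[of 1] by linarith
    then have r: "0 < r" using \<epsilon> by (simp add: r_def)
    have "b + r *\<^sub>R 1 \<in> seminorm_closure S"
    proof (rule positive_mem_module[OF M])
      fix \<alpha> assume \<alpha>: "\<alpha> \<in> nonneg_chars (seminorm_closure S)"
      then have "\<alpha> \<in> nonneg_chars S" using closure_subset by (auto simp: nonneg_chars_def)
      then have "0 \<le> \<alpha> b" using b bounded[OF \<alpha>] by blast
      moreover have "linear \<alpha>" "\<alpha> 1 = 1" using \<alpha> by (auto simp: nonneg_chars_def characters_def)
      ultimately show "0 < \<alpha> (b + r *\<^sub>R 1)" using r by (simp add: linear_add linear_scale)
    qed
    moreover have "\<rho> (b - (b + r *\<^sub>R 1)) < \<epsilon>"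
    proof -
      have "\<rho> (b - (b + r *\<^sub>R 1)) = r * \<rho> 1" using r by (simp add: minus scale)
      also have "\<dots> < r * (\<rho> 1 + 1)" using r by simp
      also have "\<dots> = \<epsilon>" using p by (simp add: r_def)
      finally show ?thesis .
    qed
    ultimately show "\<exists>y\<in>seminorm_closure S. \<rho> (b - y) < \<epsilon>" by blast
  qed
qed

end

section \<open>Seminorms from a locally multiplicatively convex topology\<close>

lemma vector_topology_translate:
  assumes "vector_topology \<tau>" "openin \<tau> U"
  shows "openin \<tau> {x. x + b \<in> U}"
proof -
  have top: "topspace \<tau> = UNIV" and
    c: "continuous_map (prod_topology \<tau> \<tau>) \<tau> (\<lambda>(x, y). x + y)"
    using assms(1) by (auto simp: vector_topology_def)
  have "continuous_map \<tau> (prod_topology \<tau> \<tau>) (\<lambda>x. (x, b))"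
    using top by (intro continuous_map_pairedI) auto
  from continuous_map_compose[OF this c] have "continuous_map \<tau> \<tau> (\<lambda>x. x + b)"
    by (simp add: o_def)
  from openin_continuous_map_preimage[OF this assms(2)] show ?thesis by (simp add: top)
qed

lemma vector_topology_scale:
  assumes "vector_topology \<tau>" "openin \<tau> U"
  shows "openin \<tau> {x. r *\<^sub>R x \<in> U}"
proof -
  have top: "topspace \<tau> = UNIV" and
    c: "continuous_map (prod_topology euclideanreal \<tau>) \<tau> (\<lambda>(r, x). r *\<^sub>R x)"
    using assms(1) by (auto simp: vector_topology_def)
  have "continuous_map \<tau> (prod_topology euclideanreal \<tau>) (\<lambda>x. (r, x))"
    using top by (intro continuous_map_pairedI) auto
  from continuous_map_compose[OF this c] have "continuous_map \<tau> \<tau> (\<lambda>x. r *\<^sub>R x)"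
    by (simp add: o_def)
  from openin_continuous_map_preimage[OF this assms(2)] show ?thesis by (simp add: top)
qed

lemma vector_topology_absorbing:
  assumes "vector_topology \<tau>" "openin \<tau> U" "0 \<in> U"
  shows "\<exists>r>0. r *\<^sub>R x \<in> U"
proof -
  have top: "topspace \<tau> = UNIV" and
    c: "continuous_map (prod_topology euclideanreal \<tau>) \<tau> (\<lambda>(r, x). r *\<^sub>R x)"
    using assms(1) by (auto simp: vector_topology_def)
  have "continuous_map euclideanreal (prod_topology euclideanreal \<tau>) (\<lambda>r. (r, x))"
    using top by (intro continuous_map_pairedI) auto
  from continuous_map_compose[OF this c] have "continuous_map euclideanreal \<tau> (\<lambda>r. r *\<^sub>R x)"
    by (simp add: o_def)
  from openin_continuous_map_preimage[OF this assms(2)] have "open {r. r *\<^sub>R x \<in> U}" by simp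
  moreover have "0 \<in> {r. r *\<^sub>R x \<in> U}" using assms(3) by simp
  ultimately obtain e where e: "0 < e" "ball 0 e \<subseteq> {r. r *\<^sub>R x \<in> U}"
    using open_contains_ball by blast
  then have "e / 2 \<in> {r. r *\<^sub>R x \<in> U}" by (intro subsetD[OF e(2)]) simp
  then show ?thesis using e(1) by (intro exI[of _ "e / 2"]) simp
qed

text \<open>
  Multiplication is bilinear, so closure under products passes to the hull in one factor at a time.
\<close>

lemma m_set_convex_hull:
  fixes V :: "'a::real_algebra set"
  assumes "m_set V"
  shows "m_set (convex hull V)"
proof -
  have "x * y \<in> convex hull V" if x: "x \<in> convex hull V" and y: "y \<in> convex hull V" for x y
  proof -
    have conv: "convex {u. u * v \<in> convex hull V}" "convex {u. v * u \<in> convex hull V}" for v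
      using convex_linear_vimage[OF _ convex_convex_hull[of V], of "\<lambda>u. u * v"]
        convex_linear_vimage[OF _ convex_convex_hull[of V], of "\<lambda>u. v * u"]
      by (simp_all add: vimage_def linearI distrib_left distrib_right)
    have left: "u * v \<in> convex hull V" if v: "v \<in> V" and u: "u \<in> convex hull V" for u v
    proof -
      have "convex hull V \<subseteq> {u. u * v \<in> convex hull V}"
        using assms v by (intro hull_minimal conv) (auto simp: m_set_def hull_inc)
      then show ?thesis using u by auto
    qed
    have "convex hull V \<subseteq> {v. x * v \<in> convex hull V}"
      using left x by (intro hull_minimal conv) auto
    then show ?thesis using y by auto
  qed
  then show ?thesis by (simp add: m_set_def)
qed

definition minkowski_gauge :: "'a::real_vector set \<Rightarrow> 'a \<Rightarrow> real" where
  "minkowski_gauge C x = Inf {r. 0 < r \<and> (1 / r) *\<^sub>R x \<in> C}"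

locale absorbing_disc =
  fixes C :: "'a::{real_algebra, comm_ring, comm_monoid_mult} set"
  assumes convex: "convex C" and symmetric: "x \<in> C \<Longrightarrow> - x \<in> C" and mset: "m_set C"
    and absorbing: "\<exists>r>0. r *\<^sub>R x \<in> C"
begin

lemma zero_in: "0 \<in> C"
  using absorbing[of 0] by simp

lemma shrink: "t *\<^sub>R x \<in> C" if "x \<in> C" "0 \<le> t" "t \<le> 1" for x t
  using convexD[OF convex that(1) zero_in, of t "1 - t"] that by simp

lemma gauge_nonneg: "0 \<le> minkowski_gauge C x"
proof -
  obtain r where "0 < r" "r *\<^sub>R x \<in> C" using absorbing by blast
  then have "{r. 0 < r \<and> (1 / r) *\<^sub>R x \<in> C} \<noteq> {}" by (auto intro!: exI[of _ "1 / r"])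
  then show ?thesis unfolding minkowski_gauge_def by (intro cInf_greatest) auto
qed

lemma gauge_le: "minkowski_gauge C x \<le> r" if "0 < r" "(1 / r) *\<^sub>R x \<in> C" for x r
  unfolding minkowski_gauge_def by (rule cInf_lower) (use that in \<open>auto intro!: bdd_belowI[of _ 0]\<close>)

lemma gauge_less_mem: "(1 / r) *\<^sub>R x \<in> C" if "minkowski_gauge C x < r" for x r
proof -
  obtain q where "0 < q" "q *\<^sub>R x \<in> C" using absorbing by blast
  then have "{r. 0 < r \<and> (1 / r) *\<^sub>R x \<in> C} \<noteq> {}" by (auto intro!: exI[of _ "1 / q"])
  from cInf_lessD[OF this that[unfolded minkowski_gauge_def]]
  obtain s where s: "0 < s" "(1 / s) *\<^sub>R x \<in> C" "s < r" by blast
  then show ?thesis using shrink[of "(1 / s) *\<^sub>R x" "s / r"] by (simp add: field_simps)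
qed

lemma gauge_scale_le: "minkowski_gauge C (c *\<^sub>R x) \<le> c * minkowski_gauge C x" if c: "0 < c" for c x
proof -
  have "minkowski_gauge C (c *\<^sub>R x) / c \<le> minkowski_gauge C x"
  proof (rule dense_ge)
    fix r assume r: "minkowski_gauge C x < r"
    then have "0 < r" using gauge_nonneg[of x] by linarith
    then have "minkowski_gauge C (c *\<^sub>R x) \<le> c * r"
      using gauge_less_mem[OF r] c by (intro gauge_le) auto
    then show "minkowski_gauge C (c *\<^sub>R x) / c \<le> r" using c by (simp add: field_simps)
  qed
  then show ?thesis using c by (simp add: field_simps)
qed

sublocale submult_seminorm "minkowski_gauge C"
proof
  fix x y :: 'a and r :: real
  show "0 \<le> minkowski_gauge C x" by (rule gauge_nonneg)
  have pos: "minkowski_gauge C (c *\<^sub>R x) = c * minkowski_gauge C x" if "0 < c" for c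
    using gauge_scale_le[OF that, of x] gauge_scale_le[of "1 / c" "c *\<^sub>R x"] that
    by (simp add: field_simps)
  have minus: "minkowski_gauge C (- z) = minkowski_gauge C z" for z
  proof -
    have "(1 / r) *\<^sub>R (- z) \<in> C \<longleftrightarrow> (1 / r) *\<^sub>R z \<in> C" for r
      using symmetric[of "(1 / r) *\<^sub>R z"] symmetric[of "(1 / r) *\<^sub>R (- z)"] by auto
    then show ?thesis by (simp add: minkowski_gauge_def)
  qed
  have "minkowski_gauge C (0::'a) \<le> 0"
    by (rule dense_ge) (simp add: gauge_le zero_in)
  then have "minkowski_gauge C (0::'a) = 0" using gauge_nonneg[of 0] by simp
  then show "minkowski_gauge C (r *\<^sub>R x) = \<bar>r\<bar> * minkowski_gauge C x"
  proof (cases r "0::real" rule: linorder_cases)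
    case less
    have "minkowski_gauge C (r *\<^sub>R x) = minkowski_gauge C ((- r) *\<^sub>R x)"
      using minus[of "r *\<^sub>R x"] by simp
    then show ?thesis using pos[of "- r"] less by simp
  qed (use pos in auto)
  show "minkowski_gauge C (x + y) \<le> minkowski_gauge C x + minkowski_gauge C y"
  proof (rule field_le_epsilon)
    fix \<epsilon> :: real assume \<epsilon>: "0 < \<epsilon>"
    define r where "r = minkowski_gauge C x + \<epsilon> / 2"
    define s where "s = minkowski_gauge C y + \<epsilon> / 2"
    have rs: "0 < r" "0 < s" using gauge_nonneg[of x] gauge_nonneg[of y] \<epsilon> by (auto simp: r_def s_def)
    have "(1 / r) *\<^sub>R x \<in> C" "(1 / s) *\<^sub>R y \<in> C"
      using \<epsilon> by (auto intro!: gauge_less_mem simp: r_def s_def)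
    from convexD[OF convex this, of "r / (r + s)" "s / (r + s)"]
    have "(1 / (r + s)) *\<^sub>R (x + y) \<in> C"
      using rs by (simp add: scaleR_add_right flip: add_divide_distrib)
    then have "minkowski_gauge C (x + y) \<le> r + s" using rs by (intro gauge_le) auto
    then show "minkowski_gauge C (x + y) \<le> minkowski_gauge C x + minkowski_gauge C y + \<epsilon>" by (simp add: r_def s_def)
  qed
  have mult: "minkowski_gauge C (x * y) \<le> r * s" if "minkowski_gauge C x < r" "minkowski_gauge C y < s" for r s
  proof (rule gauge_le)
    show "0 < r * s" using that gauge_nonneg[of x] gauge_nonneg[of y] by simp
    have "((1 / r) *\<^sub>R x) * ((1 / s) *\<^sub>R y) \<in> C"
      using mset gauge_less_mem[OF that(1)] gauge_less_mem[OF that(2)] unfolding m_set_def by blast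
    then show "(1 / (r * s)) *\<^sub>R (x * y) \<in> C" by (simp add: mult.commute)
  qed
  have "((\<lambda>\<epsilon>. (minkowski_gauge C x + \<epsilon>) * (minkowski_gauge C y + \<epsilon>)) \<longlongrightarrow> (minkowski_gauge C x + 0) * (minkowski_gauge C y + 0)) (at_right 0)"
    by (intro tendsto_intros)
  moreover have "\<forall>\<^sub>F \<epsilon> in at_right 0. minkowski_gauge C (x * y) \<le> (minkowski_gauge C x + \<epsilon>) * (minkowski_gauge C y + \<epsilon>)"
    by (rule eventually_at_right_less[THEN eventually_mono]) (auto intro: mult)
  ultimately show "minkowski_gauge C (x * y) \<le> minkowski_gauge C x * minkowski_gauge C y"
    using tendsto_lowerbound[where F = "at_right (0::real)"] by force
qed

end

text \<open>
  The two neighbourhood bases, of convex sets and of m-sets, combine into a base of absorbing discs: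
  choose a convex neighbourhood \<open>V1\<close> inside the translated set, an m-set \<open>V\<close> which together with
  \<open>- V\<close> is contained in \<open>V1\<close>, and take the convex hull of \<open>V \<union> - V\<close>. The union is again an m-set, whatever
  the signs of the factors, and the hull stays inside \<open>V1\<close>. Its Minkowski gauge is the required
  seminorm.
\<close>

lemma lmc_seminorm:
  fixes \<tau> :: "'a::{real_algebra, comm_ring, comm_monoid_mult} topology"
  assumes lmc: "lmc_topology \<tau>" and U: "openin \<tau> U" "b \<in> U"
  obtains \<rho> where "submult_seminorm \<rho>"
    "\<And>\<epsilon>. 0 < \<epsilon> \<Longrightarrow> \<exists>N. openin \<tau> N \<and> 0 \<in> N \<and> (\<forall>x\<in>N. \<rho> x \<le> \<epsilon>)"
    "\<And>x. \<rho> (x - b) < 1 \<Longrightarrow> x \<in> U"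
proof -
  have vt: "vector_topology \<tau>" and nc: "neighbourhood_base_at 0 convex \<tau>"
    and nm: "neighbourhood_base_at 0 m_set \<tau>"
    using lmc by (auto simp: lmc_topology_def locally_convex_topology_def)
  define U' where "U' = {x. x + b \<in> U}"
  have U': "openin \<tau> U'" "0 \<in> U'"
    using vector_topology_translate[OF vt U(1)] U(2) by (auto simp: U'_def)
  obtain N1 V1 where 1: "openin \<tau> N1" "convex V1" "0 \<in> N1" "N1 \<subseteq> V1" "V1 \<subseteq> U'"
    using nc U' unfolding neighbourhood_base_at_def by meson
  define W where "W = N1 \<inter> {x. - x \<in> N1}"
  have W: "openin \<tau> W" "0 \<in> W"
    using 1 vector_topology_scale[OF vt 1(1), of "- 1"] by (auto simp: W_def)
  obtain N V where 2: "openin \<tau> N" "m_set V" "0 \<in> N" "N \<subseteq> V" "V \<subseteq> W"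
    using nm W unfolding neighbourhood_base_at_def by meson
  define C where "C = convex hull (V \<union> uminus ` V)"
  have "V \<union> uminus ` V \<subseteq> V1" using 2 1 by (auto simp: W_def)
  then have CU: "C \<subseteq> U'" unfolding C_def using 1 by (meson hull_minimal order_trans)
  have NC: "N \<subseteq> C" using 2(4) hull_subset[of "V \<union> uminus ` V" convex] by (auto simp: C_def)
  interpret absorbing_disc C
  proof
    show "convex C" by (simp add: C_def)
    have "m_set (V \<union> uminus ` V)" using 2(2) by (auto simp: m_set_def)
    then show "m_set C" unfolding C_def by (rule m_set_convex_hull)
    show "\<exists>r>0. r *\<^sub>R x \<in> C" for x using vector_topology_absorbing[OF vt 2(1,3)] NC by blast
    have "uminus ` C = C"
      unfolding C_def
      by (subst convex_hull_linear_image) (auto intro: linearI simp: image_Un image_image Un_commute)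
    then show "- x \<in> C" if "x \<in> C" for x using that by blast
  qed
  show ?thesis
  proof (rule that)
    show "submult_seminorm (minkowski_gauge C)" by unfold_locales
    show "\<exists>N. openin \<tau> N \<and> 0 \<in> N \<and> (\<forall>x\<in>N. minkowski_gauge C x \<le> \<epsilon>)" if "0 < \<epsilon>" for \<epsilon>
      by (rule exI[of _ "{x. (1 / \<epsilon>) *\<^sub>R x \<in> N}"])
        (use vector_topology_scale[OF vt 2(1)] 2(3) NC that in \<open>auto intro: gauge_le\<close>)
    show "x \<in> U" if "minkowski_gauge C (x - b) < 1" for x
      using gauge_less_mem[OF that] CU by (auto simp: U'_def)
  qed
qed

lemma continuous_map_if_bounded_by_seminorm:
  fixes \<tau> :: "'a::{real_algebra, comm_ring, comm_monoid_mult} topology"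
  assumes vt: "vector_topology \<tau>" and lin: "linear \<alpha>"
    and nbhd: "\<And>\<epsilon>. 0 < \<epsilon> \<Longrightarrow> \<exists>N. openin \<tau> N \<and> 0 \<in> N \<and> (\<forall>x\<in>N. \<rho> x \<le> \<epsilon>)"
    and nonneg: "\<And>x. 0 \<le> \<rho> x" and bound: "\<And>x. \<bar>\<alpha> x\<bar> \<le> C * \<rho> x"
  shows "continuous_map \<tau> euclideanreal \<alpha>"
proof -
  have top: "topspace \<tau> = UNIV" using vt by (simp add: vector_topology_def)
  have "openin \<tau> {x. \<alpha> x \<in> V}" if "open V" for V
  proof (subst openin_subopen, safe)
    fix x assume "\<alpha> x \<in> V"
    then obtain e where e: "0 < e" "ball (\<alpha> x) e \<subseteq> V" using \<open>open V\<close> open_contains_ball by blast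
    obtain N where N: "openin \<tau> N" "0 \<in> N" "\<forall>y\<in>N. \<rho> y \<le> e / (\<bar>C\<bar> + 1)"
      using nbhd[of "e / (\<bar>C\<bar> + 1)"] e by auto
    have "\<alpha> y \<in> V" if y: "y + - x \<in> N" for y
    proof -
      have "\<bar>\<alpha> y - \<alpha> x\<bar> \<le> C * \<rho> (y + - x)" using bound[of "y + - x"] by (simp add: linear_diff[OF lin])
      moreover have "C * \<rho> (y + - x) < e"
      proof (cases "0 < C")
        case True
        have "C * \<rho> (y + - x) \<le> C * (e / (\<bar>C\<bar> + 1))"
          using True N(3) y by (intro mult_left_mono) auto
        also have "\<dots> < e" using True e by (simp add: field_simps)
        finally show ?thesis .
      next
        case False
        have "C * \<rho> (y + - x) \<le> 0"
          using False nonneg by (intro mult_nonpos_nonneg) auto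
        then show ?thesis using e by linarith
      qed
      ultimately show ?thesis using e(2) by (auto simp: dist_real_def subset_iff abs_minus_commute)
    qed
    then show "\<exists>T. openin \<tau> T \<and> x \<in> T \<and> T \<subseteq> {x. \<alpha> x \<in> V}"
      using vector_topology_translate[OF vt N(1), of "- x"] N(2)
      by (intro exI[of _ "{y. y + - x \<in> N}"]) auto
  qed
  then show ?thesis by (auto simp: continuous_map top)
qed

section \<open>Closures of power modules\<close>

text \<open>
  A character bounded by a continuous seminorm is continuous. The nonnegativity of \<open>b\<close> on the
  continuous characters is therefore all that the approximation of \<open>b\<close> within one seminorm requires.
\<close>

lemma closure_of_power_module:
  fixes \<tau> :: "'a::{real_algebra, comm_ring, comm_monoid_mult} topology"
  assumes lmc: "lmc_topology \<tau>" and k: "0 < k" and S: "power_module k S"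
  shows "\<tau> closure_of S = Pos (nonneg_chars S \<inter> spectrum \<tau>)"
proof
  have vt: "vector_topology \<tau>"
    using lmc by (auto simp: lmc_topology_def locally_convex_topology_def)
  then have top: "topspace \<tau> = UNIV" by (simp add: vector_topology_def)
  show "\<tau> closure_of S \<subseteq> Pos (nonneg_chars S \<inter> spectrum \<tau>)"
  proof (rule closure_of_minimal)
    show "S \<subseteq> Pos (nonneg_chars S \<inter> spectrum \<tau>)" by (auto simp: Pos_def nonneg_chars_def)
    have "closedin \<tau> {x. 0 \<le> \<alpha> x}" if "\<alpha> \<in> spectrum \<tau>" for \<alpha>
      using closedin_continuous_map_preimage[of \<tau> euclideanreal \<alpha> "{0..}"] that
      by (simp add: spectrum_def top)
    moreover have "Pos (nonneg_chars S \<inter> spectrum \<tau>)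
        = topspace \<tau> \<inter> (\<Inter>\<alpha>\<in>nonneg_chars S \<inter> spectrum \<tau>. {x. 0 \<le> \<alpha> x})"
      by (auto simp: Pos_def hat_def top)
    ultimately show "closedin \<tau> (Pos (nonneg_chars S \<inter> spectrum \<tau>))"
      by (cases "nonneg_chars S \<inter> spectrum \<tau> = {}") (auto intro!: closedin_Inter closedin_Int)
  qed
  show "Pos (nonneg_chars S \<inter> spectrum \<tau>) \<subseteq> \<tau> closure_of S"
  proof
    fix b assume b: "b \<in> Pos (nonneg_chars S \<inter> spectrum \<tau>)"
    have "\<exists>s\<in>S. s \<in> U" if U: "openin \<tau> U" "b \<in> U" for U
    proof -
      obtain \<rho> where sn: "submult_seminorm \<rho>"
        and nbhd: "\<And>\<epsilon>. 0 < \<epsilon> \<Longrightarrow> \<exists>N. openin \<tau> N \<and> 0 \<in> N \<and> (\<forall>x\<in>N. \<rho> x \<le> \<epsilon>)"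
        and inU: "\<And>x. \<rho> (x - b) < 1 \<Longrightarrow> x \<in> U"
        using lmc_seminorm[OF lmc U] by blast
      interpret submult_seminorm \<rho> by (rule sn)
      have "b \<in> seminorm_closure S"
      proof (rule nonneg_mem_closure[OF k S])
        fix \<alpha> C assume \<alpha>: "\<alpha> \<in> nonneg_chars S" and bound: "\<And>x. \<bar>\<alpha> x\<bar> \<le> C * \<rho> x"
        have "continuous_map \<tau> euclideanreal \<alpha>"
          by (rule continuous_map_if_bounded_by_seminorm[OF vt _ nbhd nonneg bound])
            (use \<alpha> in \<open>auto simp: nonneg_chars_def characters_def\<close>)
        then have "\<alpha> \<in> spectrum \<tau>" using \<alpha> by (simp add: spectrum_def nonneg_chars_def)
        then show "0 \<le> \<alpha> b" using \<alpha> b by (auto simp: Pos_def hat_def)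
      qed
      then obtain s where "s \<in> S" "\<rho> (b - s) < 1" using closureD[of b S 1] by auto
      then show ?thesis using inU[of s] minus[of "b - s"] by auto
    qed
    then show "b \<in> \<tau> closure_of S" by (auto simp: in_closure_of top)
  qed
qed

lemma power_module_sums_of_powers:
  "power_module k (sums_of_powers k :: 'a::{real_algebra, comm_ring, comm_monoid_mult} set)"
  unfolding power_module_def
proof (intro conjI ballI allI)
  have "(1::'a) = (\<Sum>i<1::nat. 1 ^ k)" by simp
  then show "(1::'a) \<in> sums_of_powers k" unfolding sums_of_powers_def by (intro CollectI exI)
next
  fix x y :: 'a assume "x \<in> sums_of_powers k" "y \<in> sums_of_powers k"
  then obtain n f m g where x: "x = (\<Sum>i<n::nat. f i ^ k)" and y: "y = (\<Sum>i<m::nat. g i ^ k)"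
    unfolding sums_of_powers_def by blast
  define h where "h i = (if i < n then f i else g (i - n))" for i
  have "(\<Sum>i<n + m. h i ^ k) = (\<Sum>i<n. h i ^ k) + (\<Sum>i<m. h (i + n) ^ k)"
    using sum.atLeastLessThan_concat[of 0 n "n + m" "\<lambda>i. h i ^ k"]
      sum.shift_bounds_nat_ivl[of "\<lambda>i. h i ^ k" 0 n m]
    by (simp add: lessThan_atLeast0 add.commute)
  also have "\<dots> = x + y" by (simp add: x y h_def)
  finally show "x + y \<in> sums_of_powers k" unfolding sums_of_powers_def by (intro CollectI exI) (rule sym)
next
  fix a x :: 'a assume "x \<in> sums_of_powers k"
  then obtain n f where x: "x = (\<Sum>i<n::nat. f i ^ k)" unfolding sums_of_powers_def by blast
  then have "a ^ k * x = (\<Sum>i<n. (a * f i) ^ k)" by (simp add: sum_distrib_left power_mult_distrib)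
  then show "a ^ k * x \<in> sums_of_powers k" unfolding sums_of_powers_def by (intro CollectI exI)
qed

lemma nonneg_chars_sums_of_even_powers:
  assumes "even k"
  shows "nonneg_chars (sums_of_powers k) = characters"
proof -
  have "0 \<le> \<alpha> (\<Sum>i<n. f i ^ k)" if "\<alpha> \<in> characters" for \<alpha> :: "'a \<Rightarrow> real" and f and n :: nat
  proof -
    have lin: "linear \<alpha>" and mult: "\<And>x y. \<alpha> (x * y) = \<alpha> x * \<alpha> y" and one: "\<alpha> 1 = 1"
      using that by (auto simp: characters_def)
    have "\<alpha> (x ^ k) = \<alpha> x ^ k" for x by (induction k) (simp_all add: mult one)
    then show ?thesis using assms by (simp add: linear_sum[OF lin] sum_nonneg zero_le_even_power)
  qed
  then show ?thesis by (auto simp: nonneg_chars_def sums_of_powers_def hat_def)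
qed

theorem theorem5p4:
  fixes \<tau> :: "'a::{real_algebra, comm_ring, comm_monoid_mult} topology"
    and d :: nat
  assumes "lmc_topology \<tau>" and "d \<ge> 1"
  shows "(\<forall>S. power_module (2 * d) S \<longrightarrow>
            \<tau> closure_of S = Pos (nonneg_chars S \<inter> spectrum \<tau>)) \<and>
         \<tau> closure_of (sums_of_powers (2 * d)) = Pos (spectrum \<tau>)"
proof -
  have closure: "\<tau> closure_of S = Pos (nonneg_chars S \<inter> spectrum \<tau>)" if "power_module (2 * d) S" for S
    using closure_of_power_module[OF assms(1) _ that] assms(2) by simp
  have "nonneg_chars (sums_of_powers (2 * d)) \<inter> spectrum \<tau> = spectrum \<tau>"
    by (auto simp: nonneg_chars_sums_of_even_powers spectrum_def)
  then show ?thesis using closure closure[OF power_module_sums_of_powers] by simp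
qed

end
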